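(* Let $N\ge1$ and let $K:\mathbb{F}_N^+\times\mathbb{F}_N^+\to\mathbb{C}$ be a positive definite invariant kernel with $K(\sigma,\sigma)=1$ for all $\sigma\in\mathbb{F}_N^+$. For each $n\ge0$ the matrix $R_n=[K(\sigma,\tau)]_{|\sigma|,|\tau|\le n}$ satisfies a displacement equation $$R_n-\sum_{k=1}^NF_{k,n}R_nF_{k,n}^*=G_nJ_nG_n^*,$$ for some matrix $G_n$, where $J_n$ is a symmetry of dimension $2+(2N-2)\sum_{k=0}^{n-1}N^k$.
   Context: $\mathbb{F}_N^+$ is the unital free semigroup on generators $1,\dots,N$, and $|\sigma|$ is the length of the word $\sigma$. A kernel $K$ on $\mathbb{F}_N^+$ is positive definite if $\sum_{p,q}K(\sigma_p,\sigma_q)\overline{c_p}c_q\ge0$ for all finite families $\sigma_p\in\mathbb{F}_N^+$, $c_p\in\mathbb{C}$, and invariant if $K(\tau\sigma,\tau\sigma')=K(\sigma,\sigma')$ for all $\tau,\sigma,\sigma'\in\mathbb{F}_N^+$. $\mathcal{F}_n$ is the Hilbert space of families $\{h_\sigma\}_{|\sigma|\le n}$ of complex numbers with the Euclidean norm; matrices indexed by words of length $\le n$ act on it. For $k=1,\dots,N$, $F_{k,n}$ is the operator on $\mathcal{F}_n$ given by $F_{k,n}(\{h_\sigma\}_{|\sigma|\le n})=\{g_\sigma\}_{|\sigma|\le n}$, where $g_\tau=h_\sigma$ if $\tau=k\sigma$ and $g_\tau=0$ otherwise (i.e. if $\tau$ does not begin with the letter $k$). A symmetry is a matrix $J$ with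 $J=J^*=J^{-1}$; its dimension is its size. The empty sum (for $n=0$) is $0$. *)

theory Defs
  imports "Jordan_Normal_Form.Schur_Decomposition"
begin

text \<open>
  The unital free semigroup on the generators 1, ..., N is the set of lists over \<open>{1..N}\<close>, with
  concatenation as product and the empty list as unit.
\<close>

type_synonym word = "nat list"

definition free_semigroup :: "nat \<Rightarrow> word set" where
  "free_semigroup N = lists {1..N}"

text \<open>The order on \<^typ>\<open>complex\<close> used here makes \<open>0 \<le> z\<close> mean that \<open>z\<close> is real and nonnegative.\<close>

definition positive_definite_kernel :: "nat \<Rightarrow> (word \<Rightarrow> word \<Rightarrow> complex) \<Rightarrow> bool" where
  "positive_definite_kernel N K \<longleftrightarrow>
     (\<forall>(m::nat) (\<sigma> :: nat \<Rightarrow> word) (c :: nat \<Rightarrow> complex).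
        (\<forall>p<m. \<sigma> p \<in> free_semigroup N) \<longrightarrow>
        0 \<le> (\<Sum>p<m. \<Sum>q<m. K (\<sigma> p) (\<sigma> q) * cnj (c p) * c q))"

definition invariant_kernel :: "nat \<Rightarrow> (word \<Rightarrow> word \<Rightarrow> complex) \<Rightarrow> bool" where
  "invariant_kernel N K \<longleftrightarrow>
     (\<forall>\<tau>\<in>free_semigroup N. \<forall>\<sigma>\<in>free_semigroup N. \<forall>\<sigma>'\<in>free_semigroup N.
        K (\<tau> @ \<sigma>) (\<tau> @ \<sigma>') = K \<sigma> \<sigma>')"

text \<open>
  A matrix indexed by the words of length at most \<open>n\<close> is a \<^typ>\<open>complex mat\<close> whose row (column)
  \<open>i\<close> belongs to the word \<open>words N n ! i\<close>; the choice of the enumeration is immaterial.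
\<close>

definition words :: "nat \<Rightarrow> nat \<Rightarrow> word list" where
  "words N n = concat (map (\<lambda>l. List.n_lists l [1..<Suc N]) [0..<Suc n])"

abbreviation num_words :: "nat \<Rightarrow> nat \<Rightarrow> nat" where
  "num_words N n \<equiv> length (words N n)"

lemma set_words: "set (words N n) = {\<sigma> \<in> free_semigroup N. length \<sigma> \<le> n}"
  by (auto simp: words_def free_semigroup_def set_n_lists lists_eq_set less_Suc_eq_le
      subset_eq simp del: upt_Suc)

lemma distinct_words: "distinct (words N n)"
proof (induction n)
  case 0
  then show ?case by (simp add: words_def)
next
  case (Suc n)
  have "words N (Suc n) = words N n @ List.n_lists (Suc n) [1..<Suc N]"
    unfolding words_def by (subst upt_Suc_append) (simp_all del: upt_Suc)
  then show ?case using Suc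
    by (auto simp: set_words set_n_lists distinct_n_lists
        simp del: upt_Suc List.n_lists.simps)
qed

definition kernel_matrix :: "nat \<Rightarrow> nat \<Rightarrow> (word \<Rightarrow> word \<Rightarrow> complex) \<Rightarrow> complex mat" where
  "kernel_matrix N n K =
     mat (num_words N n) (num_words N n) (\<lambda>(i, j). K (words N n ! i) (words N n ! j))"

definition prepend_letter :: "nat \<Rightarrow> (word \<Rightarrow> complex) \<Rightarrow> word \<Rightarrow> complex" where
  "prepend_letter k h \<tau> =
     (case \<tau> of [] \<Rightarrow> 0 | l # \<sigma> \<Rightarrow> if l = k then h \<sigma> else 0)"

text \<open>
  Column \<open>j\<close> of \<open>shift_matrix N n k\<close> is the image of the standard basis vector at
  \<open>words N n ! j\<close> under \<open>prepend_letter k\<close>, truncated to words of length at most \<open>n\<close>.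
\<close>

definition shift_matrix :: "nat \<Rightarrow> nat \<Rightarrow> nat \<Rightarrow> complex mat" where
  "shift_matrix N n k =
     mat (num_words N n) (num_words N n)
       (\<lambda>(i, j). prepend_letter k (\<lambda>\<sigma>. if \<sigma> = words N n ! j then 1 else 0) (words N n ! i))"

lemma shift_matrix_mult_vec:
  "shift_matrix N n k *\<^sub>v vec (num_words N n) (\<lambda>i. h (words N n ! i)) =
     vec (num_words N n) (\<lambda>i. prepend_letter k h (words N n ! i))" (is "?l = ?r")
proof (rule eq_vecI)
  fix i assume "i < dim_vec ?r"
  then have i: "i < num_words N n" by simp
  have tl: "\<sigma> \<in> set (words N n)" if "words N n ! i = l # \<sigma>" for l \<sigma>
  proof -
    have "l # \<sigma> \<in> set (words N n)" using i that by (metis nth_mem)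
    then show ?thesis by (auto simp: set_words free_semigroup_def)
  qed
  have "?l $ i = (\<Sum>j<num_words N n.
      prepend_letter k (\<lambda>\<sigma>. if \<sigma> = words N n ! j then 1 else 0) (words N n ! i) * h (words N n ! j))"
    using i by (simp add: shift_matrix_def scalar_prod_def atLeast0LessThan)
  also have "\<dots> = (\<Sum>\<rho>\<in>set (words N n).
      prepend_letter k (\<lambda>\<sigma>. if \<sigma> = \<rho> then 1 else 0) (words N n ! i) * h \<rho>)"
    by (rule sum.reindex_bij_betw[OF bij_betw_nth[OF distinct_words refl refl]])
  also have "\<dots> = prepend_letter k h (words N n ! i)"
    by (cases "words N n ! i")
      (auto simp: prepend_letter_def tl if_distrib[of "\<lambda>x. x * _"] cong: if_cong)
  finally show "?l $ i = ?r $ i" using i by simp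
qed (simp add: shift_matrix_def)

definition displacement :: "nat \<Rightarrow> nat \<Rightarrow> complex mat \<Rightarrow> complex mat" where
  "displacement N n R =
     R - finsum (module_mat TYPE(complex) (num_words N n) (num_words N n))
           (\<lambda>k. shift_matrix N n k * R * mat_adjoint (shift_matrix N n k)) {1..N}"

definition symmetry_of_dim :: "nat \<Rightarrow> complex mat \<Rightarrow> bool" where
  "symmetry_of_dim d J \<longleftrightarrow>
     J \<in> carrier_mat d d \<and> mat_adjoint J = J \<and> inverts_mat J J"

end

theory Submission
  imports Defs
begin

text \<open>
  By invariance the displacement \<open>D\<close> vanishes at every pair of words with the same first letter;
  in particular \<open>D\<close> has a zero diagonal block on the words beginning with \<open>N\<close>. A hermitian
  matrix vanishing on the block outside an index set \<open>I\<close> has the form \<open>A E\<^sup>* + E A\<^sup>*\<close>, where the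
  columns of \<open>E\<close> are the basis vectors indexed by \<open>I\<close> and those of \<open>A\<close> are columns of \<open>D\<close>, with the
  entries in \<open>I \<times> I\<close> halved. Hence \<open>D = G J G\<^sup>*\<close> for \<open>G = (A E)\<close> and \<open>J\<close> the symmetry of
  dimension \<open>2 |I|\<close> interchanging the two halves. Here \<open>I\<close> consists of the words that do not
  begin with \<open>N\<close>, whose number is half of the required dimension.
\<close>

section \<open>Entrywise rules for adjoints and finite sums of matrices\<close>

lemma mat_adjoint_dim [simp]:
  "dim_row (mat_adjoint A) = dim_col A" "dim_col (mat_adjoint A) = dim_row A"
  by (auto simp: mat_adjoint_def)

lemma mat_adjoint_carrier [simp]:
  "A \<in> carrier_mat m r \<Longrightarrow> mat_adjoint A \<in> carrier_mat r m"
  unfolding carrier_mat_def by simp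

lemma mat_adjoint_index [simp]:
  fixes A :: "complex mat"
  assumes "i < dim_col A" "j < dim_row A"
  shows "mat_adjoint A $$ (i, j) = cnj (A $$ (j, i))"
  unfolding mat_adjoint_def using assms by (subst mat_of_rows_index) simp_all

lemma mat_adjoint_zero [simp]: "mat_adjoint (0\<^sub>m m r :: complex mat) = 0\<^sub>m r m"
  by (rule eq_matI) simp_all

lemma mat_adjoint_one [simp]: "mat_adjoint (1\<^sub>m m :: complex mat) = 1\<^sub>m m"
  by (rule eq_matI) simp_all

lemma mat_adjoint_four_block_mat:
  fixes A B C D :: "complex mat"
  assumes "A \<in> carrier_mat m1 n1" "B \<in> carrier_mat m1 n2"
    "C \<in> carrier_mat m2 n1" "D \<in> carrier_mat m2 n2"
  shows "mat_adjoint (four_block_mat A B C D) =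
    four_block_mat (mat_adjoint A) (mat_adjoint C) (mat_adjoint B) (mat_adjoint D)"
proof -
  note [simp] = assms[THEN carrier_matD(1)] assms[THEN carrier_matD(2)]
  show ?thesis by (rule eq_matI) (simp_all split: if_splits)
qed

text \<open>Matrices of varying size share one type, so the sum in \<open>displacement\<close> is
  taken in the group of \<open>m\<close> by \<open>r\<close> matrices; this rule reduces it to
  ordinary sums of entries.\<close>

lemma finsum_module_mat_index:
  fixes f :: "'b \<Rightarrow> 'a :: comm_ring_1 mat"
  assumes "finite S" "\<And>k. k \<in> S \<Longrightarrow> f k \<in> carrier_mat m r"
  shows "finsum (module_mat TYPE('a) m r) f S = mat m r (\<lambda>ij. \<Sum>k\<in>S. f k $$ ij)"
proof -
  interpret abelian_group "module_mat TYPE('a) m r"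
    by (rule abelian_group_mat)
  show ?thesis using assms
  proof (induction S rule: finite_induct)
    case empty
    then show ?case by (auto simp: module_mat_simps)
  next
    case (insert k S)
    then show ?case
      by (subst finsum_insert) (auto simp: module_mat_simps Pi_def)
  qed
qed

section \<open>Factorization of hermitian matrices with a zero diagonal block\<close>

definition swap_symmetry :: "nat \<Rightarrow> complex mat" where
  "swap_symmetry r = four_block_mat (0\<^sub>m r r) (1\<^sub>m r) (1\<^sub>m r) (0\<^sub>m r r)"

lemma symmetry_of_dim_swap: "symmetry_of_dim (r + r) (swap_symmetry r)"
proof -
  have "swap_symmetry r * swap_symmetry r =
      four_block_mat (1\<^sub>m r) (0\<^sub>m r r) (0\<^sub>m r r) (1\<^sub>m r)"
    unfolding swap_symmetry_def by (subst mult_four_block_mat) auto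
  then show ?thesis
    by (simp add: symmetry_of_dim_def inverts_mat_def)
      (simp add: swap_symmetry_def mat_adjoint_four_block_mat[of _ r r _ r _ r])
qed

text \<open>The row \<open>(A B)\<close> is written as a four-block matrix whose lower blocks have
  height 0, so that block multiplication applies. The swap turns it into \<open>(B A)\<close>, and
  pairing this with the adjoint of \<open>(A B)\<close> leaves only the two mixed products.\<close>

lemma swap_symmetry_factorization:
  fixes A B :: "complex mat"
  assumes A: "A \<in> carrier_mat m r" and B: "B \<in> carrier_mat m r"
  defines "G \<equiv> four_block_mat A B (0\<^sub>m 0 r) (0\<^sub>m 0 r)"
  shows "G \<in> carrier_mat m (r + r)"
    and "G * swap_symmetry r * mat_adjoint G = A * mat_adjoint B + B * mat_adjoint A"
proof -
  note A' = mat_adjoint_carrier[OF A] and B' = mat_adjoint_carrier[OF B]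
  show "G \<in> carrier_mat m (r + r)"
    using four_block_carrier_mat[OF A, of "0\<^sub>m 0 r" 0 r] by (simp add: G_def)
  have "G * swap_symmetry r =
      four_block_mat (A * 0\<^sub>m r r + B * 1\<^sub>m r) (A * 1\<^sub>m r + B * 0\<^sub>m r r)
        (0\<^sub>m 0 r * 0\<^sub>m r r + 0\<^sub>m 0 r * 1\<^sub>m r) (0\<^sub>m 0 r * 1\<^sub>m r + 0\<^sub>m 0 r * 0\<^sub>m r r)"
    unfolding G_def swap_symmetry_def
    by (rule mult_four_block_mat[where ?nr2.0 = 0 and ?nc1.0 = r and ?nc2.0 = r, OF A B]) simp_all
  also have "\<dots> = four_block_mat B A (0\<^sub>m 0 r) (0\<^sub>m 0 r)"
    unfolding right_mult_zero_mat[OF A] right_mult_zero_mat[OF B]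
      right_mult_one_mat[OF A] right_mult_one_mat[OF B]
      left_add_zero_mat[OF B] right_add_zero_mat[OF A]
    by (intro arg_cong2[where f = "four_block_mat B A"] eq_matI) simp_all
  finally have GJ: "G * swap_symmetry r = four_block_mat B A (0\<^sub>m 0 r) (0\<^sub>m 0 r)" .
  have G': "mat_adjoint G =
      four_block_mat (mat_adjoint A) (0\<^sub>m r 0) (mat_adjoint B) (0\<^sub>m r 0)"
    unfolding G_def by (subst mat_adjoint_four_block_mat[OF A B, of _ 0]) simp_all
  have "G * swap_symmetry r * mat_adjoint G =
      four_block_mat (B * mat_adjoint A + A * mat_adjoint B) (B * 0\<^sub>m r 0 + A * 0\<^sub>m r 0)
        (0\<^sub>m 0 r * mat_adjoint A + 0\<^sub>m 0 r * mat_adjoint B)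
        (0\<^sub>m 0 r * 0\<^sub>m r 0 + 0\<^sub>m 0 r * 0\<^sub>m r 0)"
    unfolding GJ G'
    by (rule mult_four_block_mat[where ?nr2.0 = 0 and ?nc2.0 = 0, OF B A _ _ A' _ B']) simp_all
  \<comment> \<open>The other three blocks have no rows or no columns.\<close>
  also have "\<dots> = B * mat_adjoint A + A * mat_adjoint B"
    using A B by (intro eq_matI) simp_all
  also have "\<dots> = A * mat_adjoint B + B * mat_adjoint A"
    by (rule comm_add_mat[OF mult_carrier_mat[OF B A'] mult_carrier_mat[OF A B']])
  finally show "G * swap_symmetry r * mat_adjoint G = A * mat_adjoint B + B * mat_adjoint A" .
qed

lemma hermitian_zero_block_factorization:
  fixes D :: "complex mat"
  assumes D: "D \<in> carrier_mat m m"
    and herm: "\<And>i j. i < m \<Longrightarrow> j < m \<Longrightarrow> D $$ (i, j) = cnj (D $$ (j, i))"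
    and zero: "\<And>i j. i < m \<Longrightarrow> j < m \<Longrightarrow> i \<notin> I \<Longrightarrow> j \<notin> I \<Longrightarrow> D $$ (i, j) = 0"
    and I: "I \<subseteq> {..<m}"
  shows "\<exists>G J. symmetry_of_dim (card I + card I) J \<and>
    G \<in> carrier_mat m (card I + card I) \<and> D = G * J * mat_adjoint G"
proof -
  define r where "r = card I"
  have fin: "finite I" using I finite_subset by blast
  obtain e where e: "bij_betw e {0..<r} I"
    using ex_bij_betw_nat_finite[OF fin] r_def by blast
  \<comment> \<open>Positions in \<open>I\<close> times \<open>I\<close> are reached by both
    products \<open>A E*\<close> and \<open>E A*\<close>, hence the factor 1/2. Testing the row
    alone suffices, since \<open>A\<close> only uses columns \<open>e j\<close> in
    \<open>I\<close>.\<close>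
  define a where "a i p = (if i \<in> I then D $$ (i, p) / 2 else D $$ (i, p))" for i p
  define A where "A = mat m r (\<lambda>(i, j). a i (e j))"
  define E where "E = mat m r (\<lambda>(i, j). if i = e j then 1 else 0 :: complex)"
  have A: "A \<in> carrier_mat m r" and E: "E \<in> carrier_mat m r" by (auto simp: A_def E_def)
  have AE: "(A * mat_adjoint E) $$ (i, j) = (if j \<in> I then a i j else 0)"
    if "i < m" "j < m" for i j
  proof -
    have "(A * mat_adjoint E) $$ (i, j) = (\<Sum>l\<in>{0..<r}. a i (e l) * (if j = e l then 1 else 0))"
      using that by (auto simp: A_def E_def scalar_prod_def intro!: sum.cong)
    also have "\<dots> = (\<Sum>p\<in>I. a i p * (if j = p then 1 else 0))"
      by (rule sum.reindex_bij_betw[OF e])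
    finally show ?thesis using fin by (simp add: if_distrib cong: if_cong)
  qed
  have EA: "(E * mat_adjoint A) $$ (i, j) = (if i \<in> I then cnj (a j i) else 0)"
    if "i < m" "j < m" for i j
  proof -
    have "(E * mat_adjoint A) $$ (i, j) =
        (\<Sum>l\<in>{0..<r}. (if i = e l then 1 else 0) * cnj (a j (e l)))"
      using that by (auto simp: A_def E_def scalar_prod_def intro!: sum.cong)
    also have "\<dots> = (\<Sum>p\<in>I. (if i = p then 1 else 0) * cnj (a j p))"
      by (rule sum.reindex_bij_betw[OF e])
    finally show ?thesis using fin
      by (simp add: if_distrib[where f = "\<lambda>x. x * _"] cong: if_cong)
  qed
  have "D = A * mat_adjoint E + E * mat_adjoint A"
  proof (rule eq_matI)
    fix i j
    assume "i < dim_row (A * mat_adjoint E + E * mat_adjoint A)"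
      "j < dim_col (A * mat_adjoint E + E * mat_adjoint A)"
    then have ij: "i < m" "j < m" using A E by auto
    have "(A * mat_adjoint E + E * mat_adjoint A) $$ (i, j) =
        (if j \<in> I then a i j else 0) + (if i \<in> I then cnj (a j i) else 0)"
      using ij A E by (subst index_add_mat) (auto simp: AE EA simp del: index_mult_mat(1))
    \<comment> \<open>Both indices in \<open>I\<close>: two halves, equal by \<open>herm\<close>.
      Exactly one in \<open>I\<close>: a single full entry, conjugated if it is the row index. None
      in \<open>I\<close>: both sides are 0 by \<open>zero\<close>.\<close>
    also have "\<dots> = D $$ (i, j)"
      using herm[OF ij] zero[OF ij] by (auto simp: a_def)
    finally show "D $$ (i, j) = (A * mat_adjoint E + E * mat_adjoint A) $$ (i, j)" ..
  qed (use D A E in auto)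
  then show ?thesis
    using symmetry_of_dim_swap[of r] swap_symmetry_factorization[OF A E]
    unfolding r_def by metis
qed

section \<open>Hermitian symmetry of positive definite kernels\<close>

lemma positive_definite_kernel_hermitian:
  assumes pd: "positive_definite_kernel N K"
    and \<sigma>: "\<sigma> \<in> free_semigroup N" and \<tau>: "\<tau> \<in> free_semigroup N"
  shows "K \<sigma> \<tau> = cnj (K \<tau> \<sigma>)"
proof -
  \<comment> \<open>The positivity condition for the two words \<sigma>, \<tau> with coefficients
    \<open>a\<close>, \<open>b\<close>, keeping only that the form is real.\<close>
  have real2: "Im (K \<sigma> \<sigma> * cnj a * a + K \<sigma> \<tau> * cnj a * b + (K \<tau> \<sigma> * cnj b * a + K \<tau> \<tau> * cnj b * b)) = 0"
    for a b
  proof -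
    have "0 \<le> (\<Sum>p<2. \<Sum>q<2. K (if p = 0 then \<sigma> else \<tau>) (if q = 0 then \<sigma> else \<tau>) *
        cnj (if p = (0 :: nat) then a else b) * (if q = (0 :: nat) then a else b))"
      using pd[unfolded positive_definite_kernel_def] \<sigma> \<tau>
      by (elim allE[of _ 2] allE[of _ "\<lambda>p. if p = 0 then \<sigma> else \<tau>"]
          allE[of _ "\<lambda>p. if p = 0 then a else b"]) simp
    then show ?thesis
      by (simp add: numeral_2_eq_2 less_eq_complex_def del: times_complex.sel plus_complex.sel)
  qed
  \<comment> \<open>The first two choices make the diagonal values real; then (1, 1) gives opposite
    imaginary parts of \<open>K \<sigma> \<tau>\<close> and \<open>K \<tau> \<sigma>\<close>, and
    (1, \<open>\<i>\<close>) equal real parts.\<close>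
  show ?thesis
    using real2[of 1 0] real2[of 0 1] real2[of 1 1] real2[of 1 \<i>]
    by (simp add: complex_eq_iff)
qed

section \<open>Entries of the displacement of the kernel matrix\<close>

lemma words_nth_free_semigroup:
  "i < num_words N n \<Longrightarrow> words N n ! i \<in> free_semigroup N"
  using set_words[of N n] nth_mem by blast

lemma shift_matrix_carrier [simp]:
  "shift_matrix N n k \<in> carrier_mat (num_words N n) (num_words N n)"
  by (simp add: shift_matrix_def)

lemma kernel_matrix_carrier [simp]:
  "kernel_matrix N n K \<in> carrier_mat (num_words N n) (num_words N n)"
  by (simp add: kernel_matrix_def)

lemma kernel_matrix_index:
  "i < num_words N n \<Longrightarrow> j < num_words N n \<Longrightarrow>
    kernel_matrix N n K $$ (i, j) = K (words N n ! i) (words N n ! j)"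
  by (simp add: kernel_matrix_def)

lemma shift_matrix_conj_carrier:
  "shift_matrix N n k * kernel_matrix N n K * mat_adjoint (shift_matrix N n k)
    \<in> carrier_mat (num_words N n) (num_words N n)"
  by (rule mult_carrier_mat[OF mult_carrier_mat[OF shift_matrix_carrier kernel_matrix_carrier]
        mat_adjoint_carrier[OF shift_matrix_carrier]])

text \<open>The left factor acts by \<open>prepend_letter k\<close> on the row word; the adjoint on
  the right does the same to the column word, after a double conjugation.\<close>

lemma shift_matrix_conj_index:
  assumes ij: "i < num_words N n" "j < num_words N n"
  shows "(shift_matrix N n k * kernel_matrix N n K * mat_adjoint (shift_matrix N n k)) $$ (i, j) =
    prepend_letter k (\<lambda>\<tau>. prepend_letter k (\<lambda>\<sigma>. K \<sigma> \<tau>) (words N n ! i)) (words N n ! j)"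
proof -
  let ?m = "num_words N n" and ?w = "\<lambda>i. words N n ! i"
  define F where "F = shift_matrix N n k"
  define R where "R = kernel_matrix N n K"
  define h where "h \<tau> = prepend_letter k (\<lambda>\<sigma>. K \<sigma> \<tau>) (?w i)" for \<tau>
  have [simp]: "dim_row F = ?m" "dim_col F = ?m" "dim_row R = ?m" "dim_col R = ?m"
    by (auto simp: F_def R_def shift_matrix_def kernel_matrix_def)
  have F_apply: "(\<Sum>b<?m. F $$ (l, b) * g (?w b)) = prepend_letter k g (?w l)" if "l < ?m" for l g
    using arg_cong[OF shift_matrix_mult_vec[of N n k g], of "\<lambda>v. v $ l"] that
    unfolding F_def[symmetric] by (simp add: scalar_prod_def atLeast0LessThan)
  have FR: "(F * R) $$ (i, b) = h (?w b)" if "b < ?m" for b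
  proof -
    have "(F * R) $$ (i, b) = (\<Sum>a<?m. F $$ (i, a) * K (?w a) (?w b))"
      using ij that by (auto simp: scalar_prod_def atLeast0LessThan R_def kernel_matrix_def)
    then show ?thesis using F_apply[OF ij(1), of "\<lambda>\<sigma>. K \<sigma> (?w b)"] by (simp add: h_def)
  qed
  have "(F * R * mat_adjoint F) $$ (i, j) = (\<Sum>b<?m. (F * R) $$ (i, b) * cnj (F $$ (j, b)))"
    using ij by (subst index_mult_mat) (auto simp: scalar_prod_def atLeast0LessThan)
  also have "\<dots> = cnj (\<Sum>b<?m. F $$ (j, b) * cnj (h (?w b)))"
    by (simp add: FR mult.commute)
  also have "\<dots> = cnj (prepend_letter k (\<lambda>\<tau>. cnj (h \<tau>)) (?w j))"
    by (subst F_apply[OF ij(2)]) (rule refl)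
  \<comment> \<open>Conjugation passes through \<open>prepend_letter\<close> because the default
    value 0 is real.\<close>
  also have "\<dots> = prepend_letter k h (?w j)"
    by (simp add: prepend_letter_def split: list.split)
  finally show ?thesis by (simp add: F_def R_def h_def[abs_def])
qed

text \<open>The sum strips a common first letter from both words, which by invariance does not
  change \<open>K\<close>; so it cancels the entry exactly when such a letter exists and is 0
  otherwise.\<close>

lemma displacement_kernel_index:
  assumes inv: "invariant_kernel N K"
    and ij: "i < num_words N n" "j < num_words N n"
  shows "displacement N n (kernel_matrix N n K) $$ (i, j) =
    (if words N n ! i \<noteq> [] \<and> words N n ! j \<noteq> [] \<and> hd (words N n ! i) = hd (words N n ! j)
     then 0 else K (words N n ! i) (words N n ! j))" (is "_ = ?rhs")
proof -
  let ?u = "words N n ! i" and ?v = "words N n ! j"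
  note fs = words_nth_free_semigroup[OF ij(1)] words_nth_free_semigroup[OF ij(2)]
  have "displacement N n (kernel_matrix N n K) $$ (i, j) = K ?u ?v -
      (\<Sum>k\<in>{1..N}. prepend_letter k (\<lambda>\<tau>. prepend_letter k (\<lambda>\<sigma>. K \<sigma> \<tau>) ?u) ?v)"
    using ij unfolding displacement_def
    by (subst finsum_module_mat_index)
      (simp_all add: shift_matrix_conj_index shift_matrix_conj_carrier kernel_matrix_index
        del: index_mult_mat(1))
  also have "\<dots> = ?rhs"
  proof (cases "?u = [] \<or> ?v = []")
    case True
    then show ?thesis by (auto simp: prepend_letter_def split: list.split)
  next
    case False
    then obtain a \<sigma> b \<tau> where uv: "?u = a # \<sigma>" "?v = b # \<tau>" by (meson list.exhaust)
    have ab: "a \<in> {1..N}" "\<sigma> \<in> free_semigroup N" "\<tau> \<in> free_semigroup N"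
      using fs by (auto simp: uv free_semigroup_def)
    \<comment> \<open>Only the summand \<open>k = a\<close> can survive, and it occurs because
      \<open>a\<close> lies in \<open>{1..N}\<close>.\<close>
    have "(\<Sum>k\<in>{1..N}. prepend_letter k (\<lambda>\<tau>. prepend_letter k (\<lambda>\<sigma>. K \<sigma> \<tau>) ?u) ?v) =
        (\<Sum>k\<in>{1..N}. if a = k then (if a = b then K \<sigma> \<tau> else 0) else 0)"
      by (intro sum.cong) (auto simp: uv prepend_letter_def)
    also have "\<dots> = (if a = b then K \<sigma> \<tau> else 0)" using ab(1) by simp
    finally show ?thesis
      using inv[unfolded invariant_kernel_def, rule_format, of "[a]" \<sigma> \<tau>] ab
      by (auto simp: uv free_semigroup_def)
  qed
  finally show ?thesis .
qed

section \<open>Counting words that avoid a given first letter\<close>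

lemma card_free_semigroup_le:
  "card {\<sigma> \<in> free_semigroup N. length \<sigma> \<le> n} = (\<Sum>k\<le>n. N ^ k)"
  using card_lists_length_le[of "{1..N}" n]
  by (simp add: free_semigroup_def lists_eq_set)

text \<open>With S the sum of \<open>N ^ k\<close> over \<open>k < n\<close>, there are 1 + N S
  words in all; removing the initial \<open>a\<close> matches the excluded ones with the words of
  length below \<open>n\<close>, of which there are S.\<close>

lemma card_words_not_starting_with:
  assumes a: "a \<in> {1..N}"
  shows "card {i. i < num_words N n \<and> (words N n ! i = [] \<or> hd (words N n ! i) \<noteq> a)} =
    1 + (N - 1) * (\<Sum>k<n. N ^ k)" (is "card ?I = _")
proof -
  define W where "W = set (words N n)"
  define P where "P \<sigma> \<longleftrightarrow> \<sigma> = [] \<or> hd \<sigma> \<noteq> a" for \<sigma> :: word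
  define Z where "Z = {\<sigma> \<in> W. \<not> P \<sigma>}"
  have "bij_betw ((!) (words N n)) ?I (W - Z)"
    unfolding P_def[symmetric]
    by (rule bij_betw_subset[OF bij_betw_nth[OF distinct_words refl refl, of N n]])
      (auto simp: W_def Z_def in_set_conv_nth image_iff)
  then have "card ?I = card (W - Z)" by (rule bij_betw_same_card)
  also have "\<dots> = card W - card Z"
    by (rule card_Diff_subset) (auto simp: Z_def W_def)
  also have "card W = (\<Sum>k\<le>n. N ^ k)"
    by (simp add: W_def set_words card_free_semigroup_le)
  also have "\<dots> = 1 + N * (\<Sum>k<n. N ^ k)"
    by (simp add: sum_distrib_left sum.atMost_shift)
  also have "card Z = (\<Sum>k<n. N ^ k)"
  proof (cases n)
    \<comment> \<open>Only the empty word is present, so \<open>Z\<close> is empty, in agreement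
      with the empty sum.\<close>
    case 0
    then show ?thesis by (auto simp: Z_def P_def W_def set_words)
  next
    case (Suc n')
    have "Z = (#) a ` {\<sigma> \<in> free_semigroup N. length \<sigma> \<le> n'}"
    proof (intro equalityI subsetI)
      fix \<sigma> assume "\<sigma> \<in> Z"
      then show "\<sigma> \<in> (#) a ` {\<sigma> \<in> free_semigroup N. length \<sigma> \<le> n'}"
        by (cases \<sigma>) (auto simp: Z_def P_def W_def set_words Suc free_semigroup_def)
    qed (use a in \<open>auto simp: Z_def P_def W_def set_words Suc free_semigroup_def\<close>)
    then show ?thesis
      by (simp add: card_image card_free_semigroup_le Suc lessThan_Suc_atMost)
  qed
  finally show ?thesis using a by (cases N) auto
qed

theorem theorem4p3:
  fixes N n :: nat and K :: "word \<Rightarrow> word \<Rightarrow> complex"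
  assumes "N \<ge> 1"
    and "positive_definite_kernel N K"
    and "invariant_kernel N K"
    and "\<And>\<sigma>. \<sigma> \<in> free_semigroup N \<Longrightarrow> K \<sigma> \<sigma> = 1"
  shows "\<exists>G J. symmetry_of_dim (2 + (2 * N - 2) * (\<Sum>k<n. N ^ k)) J \<and>
           G \<in> carrier_mat (num_words N n) (2 + (2 * N - 2) * (\<Sum>k<n. N ^ k)) \<and>
           displacement N n (kernel_matrix N n K) = G * J * mat_adjoint G"
proof -
  define D where "D = displacement N n (kernel_matrix N n K)"
  \<comment> \<open>The letter \<open>N\<close> serves as the excluded first letter; it is a
    generator because \<open>N \<ge> 1\<close>.\<close>
  define I where "I = {i. i < num_words N n \<and> (words N n ! i = [] \<or> hd (words N n ! i) \<noteq> N)}"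
  note index = displacement_kernel_index[OF assms(3), of _ n, folded D_def]
  have D: "D \<in> carrier_mat (num_words N n) (num_words N n)"
    unfolding D_def displacement_def
    by (subst finsum_module_mat_index) (auto simp: shift_matrix_def)
  \<comment> \<open>The vanishing condition in \<open>index\<close> is symmetric in the two words,
    so \<open>D\<close> inherits the symmetry of \<open>K\<close>.\<close>
  have herm: "D $$ (i, j) = cnj (D $$ (j, i))" if "i < num_words N n" "j < num_words N n" for i j
    using that positive_definite_kernel_hermitian[OF assms(2) words_nth_free_semigroup[OF that(1)]
        words_nth_free_semigroup[OF that(2)]]
    by (auto simp: index)
  have zero: "D $$ (i, j) = 0"
    if "i < num_words N n" "j < num_words N n" "i \<notin> I" "j \<notin> I" for i j
    using that by (auto simp: index I_def)
  have card: "card I + card I = 2 + (2 * N - 2) * (\<Sum>k<n. N ^ k)"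
    using card_words_not_starting_with[of N N n] assms(1)
    by (simp add: I_def algebra_simps diff_mult_distrib2)
  have "I \<subseteq> {..<num_words N n}" by (auto simp: I_def)
  with herm zero have "\<exists>G J. symmetry_of_dim (card I + card I) J \<and>
      G \<in> carrier_mat (num_words N n) (card I + card I) \<and> D = G * J * mat_adjoint G"
    by (intro hermitian_zero_block_factorization[OF D]) blast+
  then show ?thesis unfolding D_def card .
qed

end
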